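(* For every positive integer $n$, the star graph $S_n$ of order $n$ satisfies $$E_{\mathrm{ISI}}(S_n)=\frac{2(n-1)^{3/2}}{n}.$$
   Context: The star graph $S_n$ of order $n$ is the graph on $n$ vertices isomorphic to $K_{1,n-1}$ (for $n=1$, a single vertex). For a simple graph $G$ with vertices $v_1,\dots,v_n$, let $d_i$ be the degree of $v_i$. The ISI matrix $S(G)=[s_{ij}]_{n\times n}$ has $s_{ij}=\frac{d_id_j}{d_i+d_j}$ if $v_i$ and $v_j$ are adjacent and $s_{ij}=0$ otherwise. The ISI energy is $E_{\mathrm{ISI}}(G)=\sum_{i=1}^n|\tau_i|$, where $\tau_1,\dots,\tau_n$ are the eigenvalues of $S(G)$ counted with multiplicity. *)

theory Defs
  imports
    Complex_Main
    "HOL-Computational_Algebra.Fundamental_Theorem_Algebra"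
    "Jordan_Normal_Form.Char_Poly"
    "Graph_Theory.Kuratowski"
begin

text \<open>
  A finite simple graph is a symmetric digraph without loops and multiple arcs (locale
  \<^locale>\<open>graph\<close>): each edge \<open>uv\<close> is the pair of arcs \<open>u \<rightarrow> v\<close> and \<open>v \<rightarrow> u\<close>. Hence the degree of
  a vertex is its out-degree.
\<close>

abbreviation star_graph :: "nat \<Rightarrow> ('a, 'b) pre_digraph \<Rightarrow> bool" where
  "star_graph n G \<equiv> complete_bipartite_digraph 1 (n - 1) G"

text \<open>The list \<open>vs\<close> is the numbering of the vertices by which rows and columns are indexed.\<close>

definition ISI_matrix :: "('a, 'b) pre_digraph \<Rightarrow> 'a list \<Rightarrow> real mat" where
  "ISI_matrix G vs = mat (length vs) (length vs) (\<lambda>(i, j).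
     let d = (\<lambda>k. real (out_degree G (vs ! k)))
     in if (vs ! i, vs ! j) \<in> arcs_ends G then d i * d j / (d i + d j) else 0)"

text \<open>
  The eigenvalues with algebraic multiplicity, taken over the complex numbers, so that a matrix
  of size \<open>n\<close> has exactly \<open>n\<close> of them.
\<close>

definition eigenvalues :: "real mat \<Rightarrow> complex multiset" where
  "eigenvalues A = proots (char_poly (map_mat complex_of_real A))"

lemma size_eigenvalues:
  assumes "A \<in> carrier_mat n n"
  shows "size (eigenvalues A) = n"
  using assms by (simp add: eigenvalues_def size_proots_complex degree_monic_char_poly[of _ n])

lemma set_mset_eigenvalues:
  assumes "A \<in> carrier_mat n n"
  shows "set_mset (eigenvalues A) = {\<tau>. eigenvalue (map_mat complex_of_real A) \<tau>}"
proof -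
  have A: "map_mat complex_of_real A \<in> carrier_mat n n"
    using assms by simp
  have "char_poly (map_mat complex_of_real A) \<noteq> 0"
    using degree_monic_char_poly[OF A] by auto
  then show ?thesis
    by (auto simp: eigenvalues_def eigenvalue_root_char_poly[OF A])
qed

definition ISI_energy :: "('a, 'b) pre_digraph \<Rightarrow> 'a list \<Rightarrow> real" where
  "ISI_energy G vs = (\<Sum>\<tau>\<in>#eigenvalues (ISI_matrix G vs). cmod \<tau>)"

end

theory Submission
  imports Defs
begin

text \<open>
  Up to the numbering of the vertices, the ISI matrix of a star has the weight
  \<open>s = (n - 1) / n\<close> in the row and the column of the centre, off the diagonal, and zeros elsewhere.
  Multiplying \<open>x I - S\<close> on the right by the identity matrix whose centre column is replaced by
  \<open>x\<close> at the centre and \<open>s\<close> elsewhere clears the centre column off the diagonal. Hence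
  \<open>x \<chi>(x) = x\<^sup>n\<^sup>-\<^sup>1 (x\<^sup>2 - (n - 1) s\<^sup>2)\<close> for the characteristic polynomial \<open>\<chi>\<close>, and the only nonzero
  eigenvalues are \<open>\<plusminus> s \<surd>(n - 1)\<close>.
\<close>

lemma det_column_only_diag:
  fixes A :: "'a :: comm_ring_1 mat"
  assumes "A \<in> carrier_mat n n" and "c < n"
    and "\<And>i. i < n \<Longrightarrow> i \<noteq> c \<Longrightarrow> A $$ (i, c) = 0"
  shows "det A = A $$ (c, c) * det (mat_delete A c c)"
proof -
  have "det A = (\<Sum>i<n. A $$ (i, c) * cofactor A i c)"
    by (rule laplace_expansion_column[OF assms(1,2)])
  also have "\<dots> = (\<Sum>i\<in>{c}. A $$ (i, c) * cofactor A i c)"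
    using assms by (intro sum.mono_neutral_right) auto
  finally show ?thesis
    by (simp add: cofactor_def)
qed

lemma det_row_only_diag:
  fixes A :: "'a :: comm_ring_1 mat"
  assumes "A \<in> carrier_mat n n" and "c < n"
    and "\<And>j. j < n \<Longrightarrow> j \<noteq> c \<Longrightarrow> A $$ (c, j) = 0"
  shows "det A = A $$ (c, c) * det (mat_delete A c c)"
proof -
  have "det A = (\<Sum>j<n. A $$ (c, j) * cofactor A c j)"
    by (rule laplace_expansion_row[OF assms(1,2)])
  also have "\<dots> = (\<Sum>j\<in>{c}. A $$ (c, j) * cofactor A c j)"
    using assms by (intro sum.mono_neutral_right) auto
  finally show ?thesis
    by (simp add: cofactor_def)
qed

text \<open>The index \<open>c\<close> is free because the numbering of the vertices is arbitrary.
  The entry type is free because the matrix is real while its eigenvalues are taken over the complex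
  numbers.\<close>

definition star_mat :: "nat \<Rightarrow> nat \<Rightarrow> 'a :: zero \<Rightarrow> 'a mat" where
  "star_mat n c s = mat n n (\<lambda>(i, j). if (i = c) \<noteq> (j = c) then s else 0)"

text \<open>The factor \<open>[:0, 1:]\<close> on the left is the determinant of the multiplier.
  Dividing it out would give the exponent \<open>n - 2\<close>, which truncates to a wrong value at
  \<open>n = 1\<close>.\<close>

lemma char_poly_star_mat:
  fixes s :: "'a :: comm_ring_1"
  assumes c: "c < n"
  shows "[:0, 1:] * char_poly (star_mat n c s) =
    [:0, 1:] ^ (n - 1) * [:- (of_nat (n - 1) * s\<^sup>2), 0, 1:]"
proof -
  let ?x = "[:0, 1:] :: 'a poly"
  define M where "M = char_poly_matrix (star_mat n c s)"
  define N where
    "N = mat n n (\<lambda>(i, j). if j = c then if i = c then ?x else [:s:] else if i = j then 1 else 0)"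
  have M: "M \<in> carrier_mat n n"
    by (auto simp: M_def star_mat_def)
  have N: "N \<in> carrier_mat n n"
    by (simp add: N_def)
  have M_eq: "M $$ (i, j) = (if i = j then ?x else if i = c \<or> j = c then - [:s:] else 0)"
    if "i < n" "j < n" for i j
    using that by (auto simp: M_def char_poly_matrix_def star_mat_def)
  have MN: "M * N \<in> carrier_mat n n"
    using M N by simp
  have prod: "(M * N) $$ (i, j) = (\<Sum>k<n. M $$ (i, k) * N $$ (k, j))" if "i < n" "j < n" for i j
    using that M N by (auto simp: scalar_prod_def atLeast0LessThan intro!: sum.cong)
  have other_col: "(M * N) $$ (i, j) = M $$ (i, j)" if "i < n" "j < n" "j \<noteq> c" for i j
  proof -
    have "(M * N) $$ (i, j) = (\<Sum>k<n. if k = j then M $$ (i, k) else 0)"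
      unfolding prod[OF that(1,2)] using that by (intro sum.cong) (auto simp: N_def)
    then show ?thesis
      using that by (simp add: sum.delta)
  qed
  have centre_col: "(M * N) $$ (i, c) = M $$ (i, c) * ?x + (\<Sum>k\<in>{..<n} - {c}. M $$ (i, k) * [:s:])"
    if "i < n" for i
  proof -
    have "(M * N) $$ (i, c) =
        M $$ (i, c) * N $$ (c, c) + (\<Sum>k\<in>{..<n} - {c}. M $$ (i, k) * N $$ (k, c))"
      unfolding prod[OF that c] using c by (intro sum.remove) auto
    also have "(\<Sum>k\<in>{..<n} - {c}. M $$ (i, k) * N $$ (k, c)) = (\<Sum>k\<in>{..<n} - {c}. M $$ (i, k) * [:s:])"
      using c by (intro sum.cong) (auto simp: N_def)
    finally show ?thesis
      using c by (simp add: N_def)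
  qed
  \<comment> \<open>Off the centre, row \<open>i\<close> of \<open>M\<close> is nonzero only at
    \<open>c\<close> and at \<open>i\<close>; these entries contribute \<open>- s x\<close> and
    \<open>x s\<close>, which cancel.\<close>
  have off_diag: "(M * N) $$ (i, c) = 0" if "i < n" "i \<noteq> c" for i
  proof -
    have "(\<Sum>k\<in>{..<n} - {c}. M $$ (i, k) * [:s:]) = (\<Sum>k\<in>{..<n} - {c}. if k = i then ?x * [:s:] else 0)"
      using that by (intro sum.cong) (auto simp: M_eq)
    also have "\<dots> = ?x * [:s:]"
      using that by (simp add: sum.delta)
    finally show ?thesis
      using that c by (simp add: centre_col M_eq)
  qed
  \<comment> \<open>The diagonal entry of \<open>M\<close> gives \<open>x\<^sup>2\<close>, and each
    of the \<open>n - 1\<close> leaves gives \<open>- s\<^sup>2\<close>.\<close>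
  have diag: "(M * N) $$ (c, c) = [:- (of_nat (n - 1) * s\<^sup>2), 0, 1:]"
  proof -
    have "(\<Sum>k\<in>{..<n} - {c}. M $$ (c, k) * [:s:]) = (\<Sum>k\<in>{..<n} - {c}. - [:s\<^sup>2:])"
      using c by (intro sum.cong) (auto simp: M_eq power2_eq_square)
    also have "\<dots> = [:- (of_nat (n - 1) * s\<^sup>2):]"
      using c by (simp add: of_nat_poly)
    finally show ?thesis
      using c by (simp add: centre_col M_eq)
  qed
  have "mat_delete (M * N) c c = ?x \<cdot>\<^sub>m 1\<^sub>m (n - 1)"
    using MN M N by (intro eq_matI) (auto simp: mat_delete_def other_col M_eq simp del: index_mult_mat(1))
  then have det_MN: "det (M * N) = [:- (of_nat (n - 1) * s\<^sup>2), 0, 1:] * ?x ^ (n - 1)"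
    by (simp add: det_column_only_diag[OF MN c off_diag] diag)
  have "mat_delete N c c = 1\<^sub>m (n - 1)"
    using N by (intro eq_matI) (auto simp: mat_delete_def N_def)
  \<comment> \<open>Column \<open>c\<close> of \<open>N\<close> is full, but row \<open>c\<close>
    vanishes off the diagonal, so the expansion is along the row.\<close>
  then have "det N = ?x"
    using c by (subst det_row_only_diag[OF N c]) (auto simp: N_def)
  then show ?thesis
    using det_MN det_mult[OF M N] by (simp add: char_poly_def M_def mult.commute)
qed

text \<open>The quadratic factor splits with roots \<open>r\<close> and \<open>- r\<close>, where
  \<open>r\<close> is nonnegative because \<open>s\<close> is.\<close>

lemma sum_cmod_eigenvalues_star_mat:
  assumes "c < n" and "s \<ge> 0"
  shows "(\<Sum>\<tau>\<in>#eigenvalues (star_mat n c s). cmod \<tau>) = 2 * (sqrt (real (n - 1)) * s)"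
proof -
  define r where "r = sqrt (real (n - 1)) * s"
  let ?x = "[:0, 1:] :: complex poly"
  let ?\<chi> = "char_poly (map_mat complex_of_real (star_mat n c s))"
  have "map_mat complex_of_real (star_mat n c s) = star_mat n c (complex_of_real s)"
    by (auto simp: star_mat_def)
  then have eq: "?x * ?\<chi> = ?x ^ (n - 1) * [:- (of_nat (n - 1) * (complex_of_real s)\<^sup>2), 0, 1:]"
    using char_poly_star_mat[OF assms(1)] by metis
  have "of_nat (n - 1) * (complex_of_real s)\<^sup>2 = (complex_of_real r)\<^sup>2"
    by (simp add: r_def power_mult_distrib flip: of_real_power)
  then have fact: "?x * ?\<chi> = ?x ^ (n - 1) * ([:complex_of_real r, 1:] * [:- complex_of_real r, 1:])"
    unfolding eq by (simp add: power2_eq_square)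
  have "?x * ?\<chi> \<noteq> 0"
    unfolding fact by (simp del: mult_pCons_left mult_pCons_right)
  then have nz: "?\<chi> \<noteq> 0"
    by auto
  have "proots (?x * ?\<chi>) = {#0#} + eigenvalues (star_mat n c s)"
    using nz by (subst proots_mult) (auto simp: eigenvalues_def)
  moreover have "proots (?x ^ (n - 1) * ([:complex_of_real r, 1:] * [:- complex_of_real r, 1:])) =
      replicate_mset (n - 1) 0 + ({#- complex_of_real r#} + {#complex_of_real r#})"
    by (simp add: proots_mult proots_power del: mult_pCons_left mult_pCons_right)
  ultimately have "{#0#} + eigenvalues (star_mat n c s) =
      replicate_mset (n - 1) 0 + ({#- complex_of_real r#} + {#complex_of_real r#})"
    using fact by simp
  \<comment> \<open>Zeros have modulus 0, so the extra root on the left and the \<open>n - 1\<close>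
    zeros on the right drop out without any cancellation of multisets.\<close>
  from arg_cong[OF this, of "\<lambda>E. \<Sum>\<tau>\<in>#E. cmod \<tau>"] show ?thesis
    using assms(2) by (simp add: r_def norm_mult)
qed

text \<open>Without parallel arcs, \<open>head G\<close> is injective on the arcs leaving
  \<open>v\<close>. This transfers degrees, which count arcs, to the pairs that describe a
  star.\<close>

lemma (in nomulti_digraph) out_degree_eq_card_arcs_ends:
  "out_degree G v = card {w. (v, w) \<in> arcs_ends G}"
proof -
  have "bij_betw (head G) (out_arcs G v) {w. (v, w) \<in> arcs_ends G}"
    by (rule bij_betw_imageI)
      (auto simp: inj_on_def arcs_ends_def arc_to_ends_def intro: no_multi_arcs)
  then show ?thesis
    by (simp add: out_degree_def bij_betw_same_card)
qed

text \<open>The centre has degree \<open>n - 1\<close> and each leaf degree 1, so every edge has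
  weight \<open>(n - 1) * 1 / ((n - 1) + 1)\<close>. The witness \<open>c\<close> is the position of
  the centre in \<open>vs\<close>.\<close>

lemma ISI_matrix_star_graph:
  assumes "n \<ge> 1" and "star_graph n G" and "distinct vs" and "set vs = verts G"
  obtains c where "c < n" and "ISI_matrix G vs = star_mat n c ((real n - 1) / real n)"
proof -
  obtain U V where G: "graph G" and UV: "verts G = U \<union> V" "U \<inter> V = {}"
    and "card U = 1" and V: "card V = n - 1" and arcs: "arcs_ends G = U \<times> V \<union> V \<times> U"
    using assms(2) unfolding complete_bipartite_digraph_def by auto
  then obtain u where U: "U = {u}"
    using card_1_singletonE by metis
  interpret graph G by fact
  have "finite V"
    using finite_verts UV(1) by (metis finite_Un)
  then have len: "length vs = n"
    using assms UV U V distinct_card[of vs] by simp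
  have u: "u \<notin> V"
    using UV U by auto
  have "{w. (u, w) \<in> arcs_ends G} = V"
    using arcs U u by auto
  then have deg_u: "out_degree G u = n - 1"
    by (simp add: out_degree_eq_card_arcs_ends V)
  have deg_V: "out_degree G v = 1" if "v \<in> V" for v
  proof -
    have "{w. (v, w) \<in> arcs_ends G} = {u}"
      using arcs U u that by auto
    then show ?thesis
      by (simp add: out_degree_eq_card_arcs_ends)
  qed
  obtain c where c: "c < n" "vs ! c = u"
    using assms(4) UV U len by (metis UnI1 in_set_conv_nth singletonI)
  have is_u: "vs ! i = u \<longleftrightarrow> i = c" if "i < n" for i
    using that c assms(3) len nth_eq_iff_index_eq by metis
  have in_V: "vs ! i \<in> V \<longleftrightarrow> i \<noteq> c" if "i < n" for i
    using that is_u[OF that] assms(4) UV U u len nth_mem[of i vs] by auto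
  have "ISI_matrix G vs = star_mat n c ((real n - 1) / real n)"
    using assms(1) c(1) u
    by (intro eq_matI)
      (auto simp: ISI_matrix_def star_mat_def len Let_def arcs U is_u in_V deg_u[folded c(2)] deg_V of_nat_diff)
  with c that show thesis
    by blast
qed

theorem corollary3p2p1:
  fixes n :: nat and G :: "('a, 'b) pre_digraph" and vs :: "'a list"
  assumes "n \<ge> 1"
    and "star_graph n G"
    and "distinct vs" and "set vs = verts G"
  shows "ISI_energy G vs = 2 * (real n - 1) powr (3 / 2) / real n"
proof -
  obtain c where c: "c < n" and S: "ISI_matrix G vs = star_mat n c ((real n - 1) / real n)"
    using ISI_matrix_star_graph[OF assms] .
  have "ISI_energy G vs = 2 * (sqrt (real (n - 1)) * ((real n - 1) / real n))"
    unfolding ISI_energy_def S using c assms(1) by (intro sum_cmod_eigenvalues_star_mat) auto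
  moreover have "(real n - 1) powr (3 / 2) = sqrt (real n - 1) * (real n - 1)"
  proof -
    \<comment> \<open>Splitting \<open>3 / 2\<close> as \<open>1 / 2 + 1\<close> separates the
      square root; this also holds for base 0, the case \<open>n = 1\<close>.\<close>
    have "(real n - 1) powr (1 / 2 + 1) = sqrt (real n - 1) * (real n - 1)"
      using assms(1) unfolding powr_add by (simp add: powr_half_sqrt)
    then show ?thesis
      by simp
  qed
  ultimately show ?thesis
    using assms(1) by (simp add: of_nat_diff)
qed

end
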